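(* Let $c\in\mathbb{N}$ be the number of paths from node $v_{\mathrm{P}}$ to node $v_{\mathrm{C}}$ in a directed acyclic graph $G$, and let $\mathcal{P}_1,\ldots,\mathcal{P}_c$ be these paths. Let $\{l_{\mathcal{P}_i}(t)\in\{0,1\}\}_{t\in\mathbb{N}_0}$, $i\in\{1,\ldots,c\}$, be the binary-valued failure indicator processes of the paths (not assumed to be mutually independent), and let the failure indicator of the network be $$l_G(t)=l_{\mathcal{P}_1}(t)\wedge l_{\mathcal{P}_2}(t)\wedge\cdots\wedge l_{\mathcal{P}_c}(t),\quad t\in\mathbb{N}_0.$$ Assume that for each $i\in\{1,\ldots,c\}$ we have $l_{\mathcal{P}_i}\in\Lambda_{\rho_{\mathcal{P}_i}}$, where $\rho_{\mathcal{P}_i}\in[0,1]$. Then $l_G\in\Lambda_{\rho_G}$ with $\rho_G\triangleq\min_{i\in\{1,\ldots,c\}}\rho_{\mathcal{P}_i}$.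
   Context: All processes are defined on a common probability space $(\Omega,\mathcal{F},\mathbb{P})$. $\mathbb{N}_0$ and $\mathbb{N}$ denote the nonnegative and the positive integers. For binary numbers, $\wedge$ denotes the and-operation. Class $\Lambda_\rho$: for $\rho\in[0,1]$, $\Lambda_\rho$ is the class of binary-valued processes $l=\{l(t)\in\{0,1\}\}_{t\in\mathbb{N}_0}$ such that $$\sum_{k=1}^{\infty}\mathbb{P}\Big[\sum_{t=0}^{k-1}l(t)>\rho k\Big]<\infty .$$ Interpretation: $G$ models a multi-hop communication network from the plant node $v_{\mathrm{P}}$ to the controller node $v_{\mathrm{C}}$; $l_{\mathcal{P}_i}(t)=1$ means that the packet of time $t$ is not successfully transmitted along path $\mathcal{P}_i$, and $l_G(t)=1$ means that transmission fails on all paths. *)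

theory Defs
  imports "HOL-Probability.Probability" "Graph_Theory.Arc_Walk"
begin

unbundle bit_operations_syntax

text \<open>A loop counts as a cycle here, so it is excluded as well.\<close>
locale dag = wf_digraph +
  assumes acyclic: "\<not> cycle p"

text \<open>
  Processes are written with the time argument first. Measurability into
  \<^term>\<open>count_space {0, 1}\<close> says both that each \<^term>\<open>l t\<close> is a random variable and that it
  takes only the values 0 and 1. The series over positive \<open>k\<close> is indexed by \<open>k = Suc n\<close>.
\<close>
definition Lambda_class :: "'w measure \<Rightarrow> real \<Rightarrow> (nat \<Rightarrow> 'w \<Rightarrow> nat) set" where
  "Lambda_class M \<rho> =
     {l. (\<forall>t. l t \<in> M \<rightarrow>\<^sub>M count_space {0, 1}) \<and>
         summable (\<lambda>n. \<P>(\<omega> in M. real (\<Sum>t = 0..Suc n - 1. l t \<omega>) > \<rho> * real (Suc n)))}"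

text \<open>
  \<open>l (P 1) t \<omega> AND l (P 2) t \<omega> AND \<dots> AND l (P c) t \<omega>\<close>, for \<open>c \<ge> 1\<close>; on 0 and 1 the bitwise
  operation \<open>AND\<close> is the binary and-operation.
\<close>
definition network_failure ::
    "('p \<Rightarrow> nat \<Rightarrow> 'w \<Rightarrow> nat) \<Rightarrow> (nat \<Rightarrow> 'p) \<Rightarrow> nat \<Rightarrow> nat \<Rightarrow> 'w \<Rightarrow> nat" where
  "network_failure l P c t \<omega> =
     foldl (AND) (l (P 1) t \<omega>) (map (\<lambda>i. l (P i) t \<omega>) [2..<Suc c])"

end

theory Submission
  imports Defs
begin

text \<open>
  A conjunction of binary numbers is at most each of its factors. Hence, for an index \<open>i\<close> at which
  the minimum of the rates is attained, the event that the partial sum of the network failures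
  exceeds \<open>\<rho> k\<close> is contained in the same event for the failures of the path \<open>P i\<close>, and the
  series for the network converges by comparison.
\<close>

text \<open>The start value \<open>a\<close> varies in the induction because one step of the fold
  replaces it by \<open>a AND x\<close>. This is again binary, as the four cases for
  \<open>a\<close> and \<open>x\<close> show.\<close>

lemma foldl_and_binary:
  fixes a :: nat
  assumes "a \<in> {0, 1}" and "set xs \<subseteq> {0, 1}"
  shows "foldl (AND) a xs = of_bool (\<forall>x\<in>insert a (set xs). x = 1)"
  using assms
proof (induction xs arbitrary: a)
  case (Cons x xs)
  then have "a = 0 \<or> a = 1" and "x = 0 \<or> x = 1"
    by auto
  with Cons show ?case
    by (elim disjE) auto
qed auto

text \<open>This replaces the fold by a quantifier over the paths, from which both measurability and
  the bound by each factor can be read off.\<close>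

lemma network_failure_binary:
  assumes "c \<ge> 1" and bin: "\<And>i. i \<in> {1..c} \<Longrightarrow> l (P i) t \<omega> \<in> {0, 1}"
  shows "network_failure l P c t \<omega> = of_bool (\<forall>i\<in>{1..c}. l (P i) t \<omega> = 1)"
proof -
  \<comment> \<open>The fold starts with path 1 as its initial value, and its list runs over the
    remaining indices.\<close>
  have idx: "{1..c} = insert 1 {2..<Suc c}"
    using \<open>c \<ge> 1\<close> by auto
  have "network_failure l P c t \<omega> =
      of_bool (\<forall>x\<in>insert (l (P 1) t \<omega>) (set (map (\<lambda>i. l (P i) t \<omega>) [2..<Suc c])). x = 1)"
    unfolding network_failure_def
  proof (rule foldl_and_binary)
    show "l (P 1) t \<omega> \<in> {0, 1}"
      using \<open>c \<ge> 1\<close> by (intro bin) simp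
    show "set (map (\<lambda>i. l (P i) t \<omega>) [2..<Suc c]) \<subseteq> {0, 1}"
      unfolding set_map set_upt by (intro image_subsetI bin) simp
  qed
  also have "\<dots> = of_bool (\<forall>i\<in>{1..c}. l (P i) t \<omega> = 1)"
    unfolding idx by (rule arg_cong[where f = of_bool]) auto
  finally show ?thesis .
qed

text \<open>Measurability of \<open>l\<close> is a separate assumption, since it does not follow
  from domination by \<open>m\<close>.\<close>

lemma Lambda_class_mono:
  assumes "prob_space M" and m: "m \<in> Lambda_class M \<rho>"
    and meas: "\<And>t. l t \<in> M \<rightarrow>\<^sub>M count_space {0, 1}"
    and le: "\<And>t \<omega>. \<omega> \<in> space M \<Longrightarrow> l t \<omega> \<le> m t \<omega>"
  shows "l \<in> Lambda_class M \<rho>"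
proof -
  interpret prob_space M by fact
  \<comment> \<open>The set {0, 1} is not closed under addition, so \<open>m t\<close> is viewed as
    a map into all naturals before its partial sums are formed.\<close>
  have [measurable]: "m t \<in> M \<rightarrow>\<^sub>M count_space UNIV" for t
    by (rule measurable_compose[where N = "count_space {0, 1}" and g = "\<lambda>x. x"])
      (use m in \<open>simp_all add: Lambda_class_def\<close>)
  have prob_le: "\<P>(\<omega> in M. real (\<Sum>t = 0..Suc n - 1. l t \<omega>) > \<rho> * real (Suc n))
      \<le> \<P>(\<omega> in M. real (\<Sum>t = 0..Suc n - 1. m t \<omega>) > \<rho> * real (Suc n))" for n
  \<comment> \<open>Monotonicity of the measure asks for measurability of the larger event only, the
    one for \<open>m\<close>.\<close>
  proof (rule finite_measure_mono)
    have "real (\<Sum>t = 0..Suc n - 1. l t \<omega>) \<le> real (\<Sum>t = 0..Suc n - 1. m t \<omega>)"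
      if "\<omega> \<in> space M" for \<omega>
      unfolding of_nat_le_iff by (intro sum_mono le that)
    then show "{\<omega> \<in> space M. real (\<Sum>t = 0..Suc n - 1. l t \<omega>) > \<rho> * real (Suc n)}
        \<subseteq> {\<omega> \<in> space M. real (\<Sum>t = 0..Suc n - 1. m t \<omega>) > \<rho> * real (Suc n)}"
      by (blast intro: less_le_trans)
  qed measurable
  have
    "summable (\<lambda>n. \<P>(\<omega> in M. real (\<Sum>t = 0..Suc n - 1. m t \<omega>) > \<rho> * real (Suc n)))"
    using m by (simp add: Lambda_class_def)
  then have
    "summable (\<lambda>n. \<P>(\<omega> in M. real (\<Sum>t = 0..Suc n - 1. l t \<omega>) > \<rho> * real (Suc n)))"
    by (rule summable_comparison_test'[where N = 0])
      (simp only: real_norm_def abs_of_nonneg measure_nonneg prob_le)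
  with meas show ?thesis
    by (simp add: Lambda_class_def)
qed

theorem proposition3p2:
  fixes M :: "'w measure"
    and G :: "('v, 'e) pre_digraph"
    and v\<^sub>P v\<^sub>C :: 'v
    and c :: nat
    and P :: "nat \<Rightarrow> 'e awalk"
    and l :: "'e awalk \<Rightarrow> nat \<Rightarrow> 'w \<Rightarrow> nat"
    and \<rho> :: "'e awalk \<Rightarrow> real"
  assumes "prob_space M"
    and "dag G"
    and "c \<ge> 1"
    and "bij_betw P {1..c} {p. pre_digraph.apath G v\<^sub>P p v\<^sub>C}"
    and "\<And>i. i \<in> {1..c} \<Longrightarrow> \<rho> (P i) \<in> {0..1}"
    and "\<And>i. i \<in> {1..c} \<Longrightarrow> l (P i) \<in> Lambda_class M (\<rho> (P i))"
  shows "network_failure l P c \<in> Lambda_class M (Min ((\<lambda>i. \<rho> (P i)) ` {1..c}))"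
proof -
  have meas: "l (P i) t \<in> M \<rightarrow>\<^sub>M count_space {0, 1}" if "i \<in> {1..c}" for i t
    using assms(6)[OF that] by (simp add: Lambda_class_def)
  \<comment> \<open>Measurability controls values only on \<open>space M\<close>, so this
    restriction is carried through all pointwise facts below.\<close>
  have bin: "l (P i) t \<omega> \<in> {0, 1}" if "i \<in> {1..c}" "\<omega> \<in> space M" for i t \<omega>
    using measurable_space[OF meas[OF that(1)] that(2)] by (simp only: space_count_space)
  have eq: "network_failure l P c t \<omega> = of_bool (\<forall>i\<in>{1..c}. l (P i) t \<omega> = 1)"
    if "\<omega> \<in> space M" for t \<omega>
    by (intro network_failure_binary \<open>c \<ge> 1\<close> bin that)
  have nf_meas: "network_failure l P c t \<in> M \<rightarrow>\<^sub>M count_space {0, 1}" for t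
  proof -
    \<comment> \<open>Failure on all paths is a finite intersection of measurable events.\<close>
    have "Measurable.pred M (\<lambda>\<omega>. \<forall>i\<in>{1..c}. l (P i) t \<omega> = 1)"
    proof (rule pred_intros_finite)
      fix i assume "i \<in> {1..c}"
      then show "Measurable.pred M (\<lambda>\<omega>. l (P i) t \<omega> = 1)"
        by (rule measurable_compose[OF meas]) simp
    qed simp
    then have "(\<lambda>\<omega>. of_bool (\<forall>i\<in>{1..c}. l (P i) t \<omega> = 1)) \<in> M \<rightarrow>\<^sub>M count_space {0, 1 :: nat}"
      by (rule measurable_compose) simp
    then show ?thesis
      by (rule measurable_cong[THEN iffD2, rotated]) (rule eq)
  qed
  \<comment> \<open>Since \<open>c \<ge> 1\<close>, the set of rates is nonempty, so its minimum is
    attained.\<close>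
  have "Min ((\<lambda>i. \<rho> (P i)) ` {1..c}) \<in> (\<lambda>i. \<rho> (P i)) ` {1..c}"
    using \<open>c \<ge> 1\<close> by (intro Min_in) auto
  then obtain i where i: "i \<in> {1..c}" and \<rho>: "Min ((\<lambda>i. \<rho> (P i)) ` {1..c}) = \<rho> (P i)"
    by blast
  have "network_failure l P c t \<omega> \<le> l (P i) t \<omega>" if "\<omega> \<in> space M" for t \<omega>
    unfolding eq[OF that] using i by auto
  then show ?thesis
    unfolding \<rho> by (rule Lambda_class_mono[OF assms(1) assms(6)[OF i] nf_meas])
qed

end
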